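(* The maximal cardinality of positively linearly independent sets in $\mathbb{R}^2$ is $4$. That is, every positively linearly independent set $\mathcal{V} = \{v^1, \ldots, v^m\} \subseteq \mathbb{R}^2$ has $|\mathcal{V}| \leq 4$, and there exists a positively linearly independent set in $\mathbb{R}^2$ with exactly $4$ elements.
   Context: For a finite set of vectors $\mathcal{V} = \{v^1, v^2, \ldots, v^m\} \subseteq \mathbb{R}^n$ (distinct vectors), the positive span of $\mathcal{V}$ is $\text{p-span}(\mathcal{V}) = \left\{\sum_{i=1}^m \alpha_i v^i : \alpha_i \geq 0 \text{ for all } i = 1, \ldots, m\right\}$. The set $\mathcal{V}$ is positively linearly independent if $v^i \notin \text{p-span}(\mathcal{V} \setminus \{v^i\})$ for all $i = 1, \ldots, m$. By convention any set consisting of exactly one vector (including $\{0\}$) is positively linearly independent, i.e. the positive span of the empty set is taken to be empty. *)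

theory Defs
  imports "HOL-Analysis.Analysis"
begin

(* Meant for finite sets: over an infinite V the sum would silently be 0.
   The empty set is treated separately because the empty sum would give {0},
   whereas the positive span of {} is {} by convention; this is what makes {0}
   positively linearly independent. *)
definition p_span :: "'a::real_vector set \<Rightarrow> 'a set" where
  "p_span V =
    (if V = {} then {}
     else {\<Sum>v\<in>V. \<alpha> v *\<^sub>R v | \<alpha> :: 'a \<Rightarrow> real. \<forall>v\<in>V. 0 \<le> \<alpha> v})"

definition pos_lin_independent :: "'a::real_vector set \<Rightarrow> bool" where
  "pos_lin_independent V \<longleftrightarrow> finite V \<and> (\<forall>v\<in>V. v \<notin> p_span (V - {v}))"

lemma pos_lin_independent_singleton: "pos_lin_independent {v}"
  by (simp add: pos_lin_independent_def p_span_def)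

end

(* Fix v in a positively independent set V of the plane.  If two further vectors
   lay strictly on the same side of the line through v, then one of them would lie
   in the cone spanned by v and the other one; and at most one further vector lies
   on the line itself, in the direction opposite to v.  So the sign of the
   determinant det (v, x) is injective on V - {v}, whence card V <= 1 + 3. *)
theory Submission
  imports Defs
begin

text \<open>\<open>b\<close> and \<open>c\<close> may coincide and the coefficients may vanish, so
  this one fact also excludes nonnegative multiples of a single vector and the zero vector beside
  another one.\<close>

lemma pos_lin_independent_not_pos_combination:
  fixes V :: "'a::real_vector set"
  assumes V: "pos_lin_independent V" and "a \<in> V" "b \<in> V" "c \<in> V" "b \<noteq> a" "c \<noteq> a"
    and "0 \<le> s" "0 \<le> t"
  shows "a \<noteq> s *\<^sub>R b + t *\<^sub>R c"
proof
  assume a: "a = s *\<^sub>R b + t *\<^sub>R c"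
  \<comment> \<open>Adding two indicators gives the weight s + t when \<open>b = c\<close>, without
    a case split.\<close>
  define \<alpha> where "\<alpha> x = (if x = b then s else 0) + (if x = c then t else 0)" for x
  have "finite (V - {a})"
    using V by (simp add: pos_lin_independent_def)
  then have "a = (\<Sum>x\<in>V - {a}. \<alpha> x *\<^sub>R x)"
    using assms(2-6) a
    by (simp add: \<alpha>_def scaleR_add_left sum.distrib if_distrib[of "\<lambda>r. r *\<^sub>R _"] cong: if_cong)
  moreover have "\<forall>x\<in>V - {a}. 0 \<le> \<alpha> x"
    using assms(7,8) by (simp add: \<alpha>_def)
  moreover have "V - {a} \<noteq> {}"
    using assms(3,5) by auto
  ultimately have "a \<in> p_span (V - {a})"
    unfolding p_span_def by auto
  then show False
    using V \<open>a \<in> V\<close> by (simp add: pos_lin_independent_def)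
qed

text \<open>Pairing v = \<Sum> \<alpha> w * w with v itself would give v \<bullet> v \<le> 0. This
  criterion serves to check the four-element example.\<close>

lemma pos_lin_independent_if_inner_nonpos:
  fixes V :: "'a::real_inner set"
  assumes "finite V" "0 \<notin> V"
    and nonpos: "\<And>v w. v \<in> V \<Longrightarrow> w \<in> V \<Longrightarrow> v \<noteq> w \<Longrightarrow> v \<bullet> w \<le> 0"
  shows "pos_lin_independent V"
  unfolding pos_lin_independent_def
proof (intro conjI ballI notI)
  fix v assume "v \<in> V" "v \<in> p_span (V - {v})"
  then obtain \<alpha> where v: "v = (\<Sum>w\<in>V - {v}. \<alpha> w *\<^sub>R w)" and \<alpha>: "\<forall>w\<in>V - {v}. 0 \<le> \<alpha> w"
    unfolding p_span_def by (auto split: if_splits)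
  have "v \<bullet> v = (\<Sum>w\<in>V - {v}. \<alpha> w * (v \<bullet> w))"
    by (subst (2) v) (simp add: inner_sum_right)
  also have "\<dots> \<le> 0"
    using \<open>v \<in> V\<close> \<alpha> nonpos by (intro sum_nonpos mult_nonneg_nonpos) auto
  finally show False
    using \<open>v \<in> V\<close> \<open>0 \<notin> V\<close> by (metis inner_gt_zero_iff not_le)
qed (fact \<open>finite V\<close>)

definition det2 :: "real ^ 2 \<Rightarrow> real ^ 2 \<Rightarrow> real" where
  "det2 x y = x $ 1 * y $ 2 - x $ 2 * y $ 1"

lemma det2_swap: "det2 y x = - det2 x y"
  by (simp add: det2_def)

text \<open>Cramer's rule with denominators cleared.\<close>

lemma det2_combination: "det2 v b *\<^sub>R a = det2 a b *\<^sub>R v + det2 v a *\<^sub>R b"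
  by (simp add: vec_eq_iff forall_2 det2_def algebra_simps)

text \<open>For nonzero \<open>v\<close>, this identifies \<open>a\<close> with its orthogonal
  projection onto the line through \<open>v\<close>.\<close>

lemma det2_zero_collinear:
  assumes "det2 v a = 0"
  shows "(v \<bullet> v) *\<^sub>R a = (v \<bullet> a) *\<^sub>R v"
proof -
  have "v $ 1 * a $ 2 = v $ 2 * a $ 1"
    using assms by (simp add: det2_def)
  then show ?thesis
    by (simp add: vec_eq_iff forall_2 inner_vec_def sum_2) algebra
qed

text \<open>The two quotients are the Cramer coordinates of \<open>a\<close> in the basis
  \<open>v\<close>, \<open>b\<close>; their signs put \<open>a\<close> into the cone of
  \<open>v\<close> and \<open>b\<close>.\<close>

lemma same_side_contra:
  assumes V: "pos_lin_independent V" and "v \<in> V" "a \<in> V" "b \<in> V" "v \<noteq> a" "a \<noteq> b"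
    and same: "0 < det2 v a / det2 v b" and "0 \<le> det2 a b / det2 v b"
  shows False
proof -
  have "det2 v b \<noteq> 0"
    using same by auto
  then have "a = (det2 a b / det2 v b) *\<^sub>R v + (det2 v a / det2 v b) *\<^sub>R b"
    using arg_cong[OF det2_combination[of v b a], of "\<lambda>x. inverse (det2 v b) *\<^sub>R x"]
    by (simp add: scaleR_add_right divide_inverse mult.commute)
  then show False
    using pos_lin_independent_not_pos_combination[OF V, of a v b] assms by auto
qed

lemma inj_on_sgn_det2:
  assumes V: "pos_lin_independent V" and "v \<in> V"
  shows "inj_on (\<lambda>x. sgn (det2 v x)) (V - {v})"
proof (rule inj_onI, rule ccontr)
  fix a b
  assume a: "a \<in> V - {v}" and b: "b \<in> V - {v}" and eq: "sgn (det2 v a) = sgn (det2 v b)"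
    and "a \<noteq> b"
  note not_comb = pos_lin_independent_not_pos_combination[OF V]
  show False
  proof (cases "det2 v a = 0")
    case True
    then have zero: "det2 v a = 0" "det2 v b = 0"
      using eq by (auto simp: sgn_zero_iff)
    \<comment> \<open>Otherwise \<open>v\<close> would be the combination of \<open>a\<close> with
      both coefficients 0.\<close>
    have "v \<noteq> 0"
      using not_comb[of v a a 0 0] a \<open>v \<in> V\<close> by auto
    have opposite: "v \<bullet> x < 0" and multiple: "x = ((v \<bullet> x) / (v \<bullet> v)) *\<^sub>R v"
      if x: "x \<in> V - {v}" and "det2 v x = 0" for x
    proof -
      show *: "x = ((v \<bullet> x) / (v \<bullet> v)) *\<^sub>R v"
        using arg_cong[OF det2_zero_collinear[OF \<open>det2 v x = 0\<close>],
            of "\<lambda>y. inverse (v \<bullet> v) *\<^sub>R y"] \<open>v \<noteq> 0\<close>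
        by (simp add: divide_inverse mult.commute)
      show "v \<bullet> x < 0"
      proof (rule ccontr)
        assume "\<not> v \<bullet> x < 0"
        then have "0 \<le> (v \<bullet> x) / (v \<bullet> v)"
          by simp
        \<comment> \<open>Here \<open>order_refl\<close> sets the second coefficient to 0, leaving a
          nonnegative multiple of \<open>v\<close>.\<close>
        from not_comb[of x v v, OF _ _ _ _ _ this order_refl] x \<open>v \<in> V\<close> * show False
          by auto
      qed
    qed
    have neg: "v \<bullet> a < 0" "v \<bullet> b < 0"
      using opposite a b zero by blast+
    \<comment> \<open>Two negative multiples of \<open>v\<close> are positive multiples of each
      other.\<close>
    have "((v \<bullet> a) / (v \<bullet> b)) *\<^sub>R b = ((v \<bullet> a) / (v \<bullet> b)) *\<^sub>R ((v \<bullet> b) / (v \<bullet> v)) *\<^sub>R v"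
      using multiple[OF b zero(2)] by simp
    also have "\<dots> = a"
      using multiple[OF a zero(1)] neg by simp
    finally have "a = ((v \<bullet> a) / (v \<bullet> b)) *\<^sub>R b + 0 *\<^sub>R b"
      by simp
    moreover have "0 \<le> (v \<bullet> a) / (v \<bullet> b)"
      using neg by (simp add: divide_nonpos_neg)
    ultimately show False
      using not_comb[of a b b] a b \<open>a \<noteq> b\<close> by blast
  next
    case False
    then have "0 < det2 v a / det2 v b" "0 < det2 v b / det2 v a"
      using eq by (auto simp: sgn_if zero_less_divide_iff split: if_splits)
    \<comment> \<open>The numerators are opposite and the denominators agree in sign, so one
      quotient is nonnegative; it decides which of \<open>a\<close> and \<open>b\<close> lies in the
      cone of \<open>v\<close> and the other.\<close>
    moreover have "0 \<le> det2 a b / det2 v b \<or> 0 \<le> det2 b a / det2 v a"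
      using calculation det2_swap[of b a]
      by (smt (verit) zero_le_divide_iff zero_less_divide_iff)
    ultimately show False
      using same_side_contra[OF V \<open>v \<in> V\<close>] a b \<open>a \<noteq> b\<close> by blast
  qed
qed

lemma card_pos_lin_independent_le_4:
  fixes V :: "(real ^ 2) set"
  assumes V: "pos_lin_independent V"
  shows "card V \<le> 4"
proof (cases "V = {}")
  case False
  then obtain v where "v \<in> V"
    by blast
  have "card (V - {v}) \<le> card {-1, 0, 1 :: real}"
    by (rule card_inj_on_le[OF inj_on_sgn_det2[OF V \<open>v \<in> V\<close>]]) (auto simp: sgn_if)
  then show ?thesis
    using \<open>v \<in> V\<close> V by (simp add: pos_lin_independent_def)
qed simp

lemma card_4_pos_lin_independent:
  "\<exists>V :: (real ^ 2) set. pos_lin_independent V \<and> card V = 4"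
proof (intro exI conjI)
  \<comment> \<open>For the unit vectors and their negatives, distinct members have inner product 0
    or -1.\<close>
  let ?V = "{vector [1, 0], vector [-1, 0], vector [0, 1], vector [0, -1]} :: (real ^ 2) set"
  show "pos_lin_independent ?V"
    by (rule pos_lin_independent_if_inner_nonpos)
      (auto simp: inner_vec_def sum_2 vec_eq_iff forall_2)
  show "card ?V = 4"
    by (simp add: vec_eq_iff forall_2)
qed

theorem proposition3:
  shows "(\<forall>V :: (real ^ 2) set. pos_lin_independent V \<longrightarrow> card V \<le> 4) \<and>
         (\<exists>V :: (real ^ 2) set. pos_lin_independent V \<and> card V = 4)"
  using card_pos_lin_independent_le_4 card_4_pos_lin_independent by blast

end
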